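(* Let $\mathbb X$ be the completion of $c_{00}$ (the finitely supported scalar sequences over $\mathbb R$ or $\mathbb C$) under the norm $$\|(a_i)_i\|:=\sup_{n\ge1}\Big|\sum_{j=1}^n a_j\Big|,$$ and let $\mathcal B=(\mathbf e_i)_{i\in\mathbb N}$ be the canonical basis of $\mathbb X$. Then there is $y\in\mathbb X$ such that for every $0<t\le1$, $$\inf_{\mathbf G_m^t(y)\in\mathcal G_m^t(y)}\|\mathbf G_m^t(y)\|\xrightarrow[m\to+\infty]{}+\infty,$$ where $\mathcal G_m^t(y)$ denotes the set of all $t$-greedy sums of $y$ of order $m$. In particular (taking $t=1$), for any strictly increasing sequence of positive integers $(m_j)_j$ and every choice of greedy sums $\mathbf G_{m_j}(y)$ of $y$ of order $m_j$, $$\|\mathbf G_{m_j}(y)-y\|\xrightarrow[j\to+\infty]{}+\infty.$$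
   Context: Let $(\mathbf e_i^* )_i\subset\mathbb X^*$ be the coordinate functionals biorthogonal to $(\mathbf e_i)_i$. For $0<t\le1$, a finite set $A\subset\mathbb N$ is a $t$-greedy set for $x\in\mathbb X$ if $\min_{i\in A}|\mathbf e_i^*(x)|\ge t\max_{i\notin A}|\mathbf e_i^*(x)|$, i.e. $|\mathbf e_i^*(x)|\ge t|\mathbf e_j^*(x)|$ for all $i\in A$, $j\notin A$. A $t$-greedy sum of $x$ of order $m$ is a vector $\mathbf G_m^t(x)=\sum_{i\in A}\mathbf e_i^*(x)\mathbf e_i$, where $A$ is a $t$-greedy set for $x$ with $|A|=m$. When $t=1$ one speaks of greedy sets and greedy sums $\mathbf G_m(x)$. *)

theory Defs
  imports "HOL-Analysis.Analysis" "HOL-Library.Poly_Mapping"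
begin

text \<open>
  The scalars are a type \<open>'k :: {real_normed_field, banach}\<close>. By the theorem of Gelfand and Mazur
  such a field is isometrically isomorphic to \<open>real\<close> or to \<open>complex\<close>, and both are instances.

  The space c00 is the type \<open>nat \<Rightarrow>\<^sub>0 'k\<close> of finitely supported functions. Indices start at 0:
  the entry at \<open>j\<close> is the mathematical entry \<open>a\<^sub>j\<^sub>+\<^sub>1\<close>, so the partial sums over the first
  \<open>n + 1\<close> entries, \<open>n :: nat\<close>, are \<open>\<Sum>j\<le>n\<close>.
\<close>

definition c00_scale :: "'k \<Rightarrow> (nat \<Rightarrow>\<^sub>0 'k) \<Rightarrow> (nat \<Rightarrow>\<^sub>0 'k::field)" where
  "c00_scale c a = Poly_Mapping.map ((*) c) a"

definition c00_norm :: "(nat \<Rightarrow>\<^sub>0 'k::real_normed_field) \<Rightarrow> real" where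
  "c00_norm a = (SUP n. norm (\<Sum>j\<le>n. Poly_Mapping.lookup a j))"

text \<open>
  The class \<open>banach\<close> only provides a real scalar multiplication. A Banach space over \<open>'k\<close> is a
  type of this class with an additional scalar multiplication that extends the real one.
\<close>

definition banach_over ::
  "('k::{real_normed_field,banach} \<Rightarrow> 'x::banach \<Rightarrow> 'x) \<Rightarrow> bool" where
  "banach_over smul \<longleftrightarrow>
     vector_space smul \<and>
     (\<forall>c x. norm (smul c x) = norm c * norm x) \<and>
     (\<forall>r x. smul (of_real r) x = r *\<^sub>R x)"

text \<open>
  A completion is a Banach space with a linear isometric embedding \<open>\<iota>\<close> of c00 whose range is
  dense; it is unique up to isometric isomorphism. That one exists is shown at the end
  of this theory.
\<close>

definition is_completion ::
  "('k::{real_normed_field,banach} \<Rightarrow> 'x::banach \<Rightarrow> 'x) \<Rightarrow> ((nat \<Rightarrow>\<^sub>0 'k) \<Rightarrow> 'x) \<Rightarrow> bool" where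
  "is_completion smul \<iota> \<longleftrightarrow>
     banach_over smul \<and>
     Vector_Spaces.linear c00_scale smul \<iota> \<and>
     (\<forall>a. norm (\<iota> a) = c00_norm a) \<and>
     closure (range \<iota>) = UNIV"

definition basis_vec :: "((nat \<Rightarrow>\<^sub>0 'k::zero_neq_one) \<Rightarrow> 'x) \<Rightarrow> nat \<Rightarrow> 'x" where
  "basis_vec \<iota> i = \<iota> (Poly_Mapping.single i 1)"

definition dual_space ::
  "('k::{real_normed_field,banach} \<Rightarrow> 'x::banach \<Rightarrow> 'x) \<Rightarrow> ('x \<Rightarrow> 'k) set" where
  "dual_space smul = {f. bounded_linear f \<and> Vector_Spaces.linear smul (*) f}"

definition coord ::
  "('k::{real_normed_field,banach} \<Rightarrow> 'x::banach \<Rightarrow> 'x) \<Rightarrow> ((nat \<Rightarrow>\<^sub>0 'k) \<Rightarrow> 'x) \<Rightarrow> nat \<Rightarrow> 'x \<Rightarrow> 'k"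
  where
  "coord smul \<iota> i =
     (THE f. f \<in> dual_space smul \<and> (\<forall>j. f (basis_vec \<iota> j) = (if i = j then 1 else 0)))"

definition greedy_set ::
  "('k::{real_normed_field,banach} \<Rightarrow> 'x::banach \<Rightarrow> 'x) \<Rightarrow> ((nat \<Rightarrow>\<^sub>0 'k) \<Rightarrow> 'x) \<Rightarrow>
   real \<Rightarrow> 'x \<Rightarrow> nat set \<Rightarrow> bool" where
  "greedy_set smul \<iota> t x A \<longleftrightarrow>
     finite A \<and>
     (\<forall>i\<in>A. \<forall>j. j \<notin> A \<longrightarrow> norm (coord smul \<iota> i x) \<ge> t * norm (coord smul \<iota> j x))"

definition greedy_sums ::
  "('k::{real_normed_field,banach} \<Rightarrow> 'x::banach \<Rightarrow> 'x) \<Rightarrow> ((nat \<Rightarrow>\<^sub>0 'k) \<Rightarrow> 'x) \<Rightarrow>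
   real \<Rightarrow> nat \<Rightarrow> 'x \<Rightarrow> 'x set" where
  "greedy_sums smul \<iota> t m x =
     {\<Sum>i\<in>A. smul (coord smul \<iota> i x) (basis_vec \<iota> i) | A.
        greedy_set smul \<iota> t x A \<and> card A = m}"

text \<open>The definite description in \<open>coord\<close> is well defined.\<close>

lemma lookup_c00_scale: "Poly_Mapping.lookup (c00_scale c a) i = c * Poly_Mapping.lookup a i"
  unfolding c00_scale_def by (simp add: map.rep_eq when_def)

lemma norm_partial_sum_le:
  "norm (\<Sum>j\<le>n. Poly_Mapping.lookup a j) \<le> c00_norm (a :: nat \<Rightarrow>\<^sub>0 'k::real_normed_field)"
  unfolding c00_norm_def
proof (rule cSUP_upper)
  show "bdd_above (range (\<lambda>n. norm (\<Sum>j\<le>n. Poly_Mapping.lookup a j)))"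
  proof (rule bdd_aboveI2)
    fix n
    have "norm (\<Sum>j\<le>n. Poly_Mapping.lookup a j) \<le> (\<Sum>j\<le>n. norm (Poly_Mapping.lookup a j))"
      by (rule norm_sum)
    also have "\<dots> = (\<Sum>j\<in>{..n} \<inter> Poly_Mapping.keys a. norm (Poly_Mapping.lookup a j))"
      by (rule sum.mono_neutral_right) (auto simp: in_keys_iff)
    also have "\<dots> \<le> (\<Sum>j\<in>Poly_Mapping.keys a. norm (Poly_Mapping.lookup a j))"
      by (rule sum_mono2) auto
    finally show "norm (\<Sum>j\<le>n. Poly_Mapping.lookup a j) \<le> (\<Sum>j\<in>Poly_Mapping.keys a. norm (Poly_Mapping.lookup a j))" .
  qed
qed simp

lemma norm_lookup_le:
  "norm (Poly_Mapping.lookup a i) \<le> 2 * c00_norm (a :: nat \<Rightarrow>\<^sub>0 'k::real_normed_field)"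
proof (cases i)
  case 0
  then show ?thesis
    using norm_partial_sum_le[of a 0] norm_ge_zero[of "Poly_Mapping.lookup a 0"]
    by (simp del: norm_ge_zero)
next
  case (Suc n)
  have "Poly_Mapping.lookup a i = (\<Sum>j\<le>Suc n. Poly_Mapping.lookup a j) - (\<Sum>j\<le>n. Poly_Mapping.lookup a j)"
    by (simp add: Suc)
  then have "norm (Poly_Mapping.lookup a i) \<le> norm (\<Sum>j\<le>Suc n. Poly_Mapping.lookup a j) + norm (\<Sum>j\<le>n. Poly_Mapping.lookup a j)"
    by (metis norm_triangle_ineq4)
  then show ?thesis
    using norm_partial_sum_le[of a "Suc n"] norm_partial_sum_le[of a n] by linarith
qed

lemma c00_expansion: "a = (\<Sum>i\<in>Poly_Mapping.keys a. c00_scale (Poly_Mapping.lookup a i) (Poly_Mapping.single i 1))"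
proof (rule poly_mapping_eqI)
  fix k
  have "Poly_Mapping.lookup (\<Sum>i\<in>Poly_Mapping.keys a. c00_scale (Poly_Mapping.lookup a i) (Poly_Mapping.single i 1)) k
      = (\<Sum>i\<in>Poly_Mapping.keys a. if i = k then Poly_Mapping.lookup a i else 0)"
    by (simp add: lookup_sum lookup_c00_scale lookup_single when_def if_distrib cong: if_cong)
  then show "Poly_Mapping.lookup a k
      = Poly_Mapping.lookup (\<Sum>i\<in>Poly_Mapping.keys a. c00_scale (Poly_Mapping.lookup a i) (Poly_Mapping.single i 1)) k"
    by (simp add: in_keys_iff)
qed

lemma coord_ex1:
  fixes smul :: "'k::{real_normed_field,banach} \<Rightarrow> 'x::banach \<Rightarrow> 'x"
  assumes "is_completion smul \<iota>"
  shows "\<exists>!f. f \<in> dual_space smul \<and> (\<forall>j. f (basis_vec \<iota> j) = (if i = j then 1 else 0))"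
proof -
  have bo: "banach_over smul" and lin: "Vector_Spaces.linear c00_scale smul \<iota>"
    and iso: "\<And>a. norm (\<iota> a) = c00_norm a" and dense: "closure (range \<iota>) = UNIV"
    using assms by (auto simp: is_completion_def)
  interpret L: Vector_Spaces.linear c00_scale smul \<iota> by (rule lin)
  have vs: "vector_space smul" and sn: "\<And>c x. norm (smul c x) = norm c * norm x"
    and sr: "\<And>r x. smul (of_real r) x = r *\<^sub>R x"
    using bo by (auto simp: banach_over_def)
  have cont_scale: "continuous_on UNIV (smul c)" for c
  proof -
    have "bounded_linear (smul c)"
    proof (rule bounded_linear_intro[where K = "norm c"])
      fix x y r
      show "smul c (x + y) = smul c x + smul c y" by (rule L.vs2.scale_right_distrib)
      show "smul c (r *\<^sub>R x) = r *\<^sub>R smul c x"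
        by (simp flip: sr add: L.vs2.scale_scale mult.commute)
      show "norm (smul c x) \<le> norm x * norm c" by (simp add: sn mult.commute)
    qed
    then show ?thesis by (rule linear_continuous_on)
  qed
  have inj: "Poly_Mapping.lookup a j = Poly_Mapping.lookup b j" if "\<iota> a = \<iota> b" for a b j
  proof -
    have "norm (\<iota> (a - b)) = 0" using that by (simp add: L.diff)
    then have "norm (Poly_Mapping.lookup (a - b) j) \<le> 0" using norm_lookup_le[of "a - b" j] iso by simp
    then show ?thesis by (simp add: lookup_minus)
  qed
  define g0 where "g0 = (\<lambda>x. Poly_Mapping.lookup (inv \<iota> x) i)"
  have g0: "g0 (\<iota> a) = Poly_Mapping.lookup a i" for a
    unfolding g0_def by (rule inj) (simp add: f_inv_into_f)
  have "2-lipschitz_on (range \<iota>) g0"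
  proof (rule lipschitz_onI)
    fix x y assume "x \<in> range \<iota>" "y \<in> range \<iota>"
    then obtain a b where "x = \<iota> a" "y = \<iota> b" by auto
    then show "dist (g0 x) (g0 y) \<le> 2 * dist x y"
      using norm_lookup_le[of "a - b" i] by (simp add: g0 dist_norm lookup_minus iso flip: L.diff)
  qed simp
  then have "uniformly_continuous_on (range \<iota>) g0"
    by (rule lipschitz_on_uniformly_continuous)
  then obtain g where gu: "uniformly_continuous_on (closure (range \<iota>)) g"
    and gg: "\<And>x. x \<in> range \<iota> \<Longrightarrow> g0 x = g x"
    by (rule uniformly_continuous_on_extension_on_closure) blast
  have gc: "continuous_on UNIV g"
    using uniformly_continuous_imp_continuous[OF gu] by (simp add: dense)
  have gi: "g (\<iota> a) = Poly_Mapping.lookup a i" for a using gg[of "\<iota> a"] g0[of a] by simp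
  have dense_eq: "f x = h x" if "continuous_on UNIV f" "continuous_on UNIV h"
    "\<And>a. f (\<iota> a) = h (\<iota> a)" for f h :: "'x \<Rightarrow> 'k" and x
  proof -
    have "closed {x. f x = h x}" using that(1,2) by (rule closed_Collect_eq)
    moreover have "range \<iota> \<subseteq> {x. f x = h x}" using that(3) by auto
    ultimately have "closure (range \<iota>) \<subseteq> {x. f x = h x}" by (rule closure_minimal[rotated])
    then show ?thesis using dense by auto
  qed
  have gcomp: "continuous_on UNIV (\<lambda>x. g (h x))" if "continuous_on UNIV h" for h :: "'x \<Rightarrow> 'x"
    using continuous_on_compose2[OF gc that] by simp
  have add: "g (x + y) = g x + g y" for x y
  proof -
    have 1: "g (x + \<iota> b) = g x + g (\<iota> b)" for x b
      by (rule dense_eq[of "\<lambda>x. g (x + \<iota> b)" "\<lambda>x. g x + g (\<iota> b)"])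
        (auto intro!: gcomp continuous_intros gc simp: gi lookup_add simp flip: L.add)
    show ?thesis
      by (rule dense_eq[of "\<lambda>y. g (x + y)" "\<lambda>y. g x + g y"])
        (auto intro!: gcomp continuous_intros gc simp: 1)
  qed
  have scl: "g (smul c x) = c * g x" for c x
    by (rule dense_eq[of "\<lambda>x. g (smul c x)" "\<lambda>x. c * g x"])
      (auto intro!: gcomp cont_scale continuous_intros gc
        simp: gi lookup_c00_scale simp flip: L.scale)
  have bound: "norm (g x) \<le> norm x * 2" for x
  proof -
    have "closed {x. norm (g x) \<le> norm x * 2}"
      by (intro closed_Collect_le continuous_intros gc)
    moreover have "range \<iota> \<subseteq> {x. norm (g x) \<le> norm x * 2}"
      using norm_lookup_le by (auto simp: gi iso mult.commute)
    ultimately have "closure (range \<iota>) \<subseteq> {x. norm (g x) \<le> norm x * 2}"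
      by (rule closure_minimal[rotated])
    then show ?thesis using dense by auto
  qed
  have vsk: "vector_space ((*) :: 'k \<Rightarrow> 'k \<Rightarrow> 'k)"
    by unfold_locales (auto simp: algebra_simps)
  have "bounded_linear g"
    by (rule bounded_linear_intro[where K = 2])
      (auto simp: add bound scl scaleR_conv_of_real simp flip: sr)
  moreover have "Vector_Spaces.linear smul (*) g"
    by (simp add: Vector_Spaces.linear_iff vs vsk add scl)
  ultimately have ex: "g \<in> dual_space smul \<and> (\<forall>j. g (basis_vec \<iota> j) = (if i = j then 1 else 0))"
    by (simp add: dual_space_def basis_vec_def gi lookup_single when_def eq_commute)
  moreover have "f = g"
    if f: "f \<in> dual_space smul \<and> (\<forall>j. f (basis_vec \<iota> j) = (if i = j then 1 else 0))" for f
  proof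
    fix x
    have fl: "Vector_Spaces.linear smul (*) f" and fb: "bounded_linear f"
      using f by (auto simp: dual_space_def)
    have fbasis: "\<And>j. f (basis_vec \<iota> j) = (if i = j then 1 else 0)"
      using f by blast
    interpret F: Vector_Spaces.linear smul "(*)" f by (rule fl)
    have fi: "f (\<iota> a) = Poly_Mapping.lookup a i" for a
    proof -
      have "f (\<iota> a) = f (\<iota> (\<Sum>i\<in>Poly_Mapping.keys a.
               c00_scale (Poly_Mapping.lookup a i) (Poly_Mapping.single i 1)))"
        using c00_expansion[of a] by simp
      also have "\<dots> = (\<Sum>j\<in>Poly_Mapping.keys a. Poly_Mapping.lookup a j * f (basis_vec \<iota> j))"
        by (simp add: L.sum L.scale F.sum F.scale basis_vec_def)
      also have "\<dots> = Poly_Mapping.lookup a i"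
        by (simp add: fbasis if_distrib in_keys_iff cong: if_cong)
      finally show ?thesis .
    qed
    show "f x = g x"
      by (rule dense_eq) (auto simp: fi gi gc linear_continuous_on[OF fb])
  qed
  ultimately show ?thesis by blast
qed

text \<open>
  Existence of a completion: the convergent sequences with the supremum norm, where \<open>\<iota>\<close> maps
  \<open>a\<close> to its sequence of partial sums.
\<close>

typedef (overloaded) 'k conv_seq =
  "{f :: nat \<Rightarrow>\<^sub>C 'k::{real_normed_field,banach}. convergent (apply_bcontfun f)}"
  by (rule exI[of _ 0]) (simp add: convergent_const)

setup_lifting type_definition_conv_seq

instantiation conv_seq :: ("{real_normed_field,banach}") real_normed_vector
begin

lift_definition zero_conv_seq :: "'a conv_seq" is 0 by (simp add: convergent_const)
lift_definition plus_conv_seq :: "'a conv_seq \<Rightarrow> 'a conv_seq \<Rightarrow> 'a conv_seq" is "(+)"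
  by (simp add: convergent_add)
lift_definition minus_conv_seq :: "'a conv_seq \<Rightarrow> 'a conv_seq \<Rightarrow> 'a conv_seq" is "(-)"
  by (simp add: convergent_diff)
lift_definition uminus_conv_seq :: "'a conv_seq \<Rightarrow> 'a conv_seq" is uminus
  by (simp add: convergent_minus_iff[symmetric])
lift_definition scaleR_conv_seq :: "real \<Rightarrow> 'a conv_seq \<Rightarrow> 'a conv_seq" is scaleR
  by (simp add: scaleR_conv_of_real convergent_mult convergent_const)
lift_definition norm_conv_seq :: "'a conv_seq \<Rightarrow> real" is norm .
definition dist_conv_seq :: "'a conv_seq \<Rightarrow> 'a conv_seq \<Rightarrow> real"
  where "dist_conv_seq x y = norm (x - y)"
definition sgn_conv_seq :: "'a conv_seq \<Rightarrow> 'a conv_seq"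
  where "sgn_conv_seq x = inverse (norm x) *\<^sub>R x"
definition uniformity_conv_seq :: "('a conv_seq \<times> 'a conv_seq) filter"
  where "uniformity_conv_seq = (INF e\<in>{0<..}. principal {(x, y). dist x y < e})"
definition open_conv_seq :: "'a conv_seq set \<Rightarrow> bool"
  where "open_conv_seq U \<longleftrightarrow> (\<forall>x\<in>U. \<forall>\<^sub>F (x', y) in uniformity. x' = x \<longrightarrow> y \<in> U)"

instance
proof
  fix a b c :: "'a conv_seq" and r s :: real and U :: "'a conv_seq set"
  show "a + b + c = a + (b + c)" by transfer (simp add: add.assoc)
  show "a + b = b + a" by transfer (simp add: add.commute)
  show "0 + a = a" by transfer simp
  show "- a + a = 0" by transfer simp
  show "a - b = a + - b" by transfer simp
  show "r *\<^sub>R (a + b) = r *\<^sub>R a + r *\<^sub>R b" by transfer (simp add: scaleR_right_distrib)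
  show "(r + s) *\<^sub>R a = r *\<^sub>R a + s *\<^sub>R a" by transfer (simp add: scaleR_left_distrib)
  show "r *\<^sub>R s *\<^sub>R a = (r * s) *\<^sub>R a" by transfer simp
  show "1 *\<^sub>R a = a" by transfer simp
  show "dist a b = norm (a - b)" by (rule dist_conv_seq_def)
  show "sgn a = inverse (norm a) *\<^sub>R a" by (rule sgn_conv_seq_def)
  show "uniformity = (INF e\<in>{0<..}. principal {(x, y :: 'a conv_seq). dist x y < e})"
    by (rule uniformity_conv_seq_def)
  show "open U \<longleftrightarrow> (\<forall>x\<in>U. \<forall>\<^sub>F (x', y) in uniformity. x' = x \<longrightarrow> y \<in> U)"
    by (rule open_conv_seq_def)
  show "norm a = 0 \<longleftrightarrow> a = 0" by transfer simp
  show "norm (a + b) \<le> norm a + norm b" by transfer (rule norm_triangle_ineq)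
  show "norm (r *\<^sub>R a) = \<bar>r\<bar> * norm a" by transfer simp
qed

end

instance conv_seq :: ("{real_normed_field,banach}") banach
proof
  fix X :: "nat \<Rightarrow> 'a conv_seq"
  assume X: "Cauchy X"
  have d: "dist (Rep_conv_seq x) (Rep_conv_seq y) = dist x y" for x y :: "'a conv_seq"
    by (simp add: dist_norm norm_conv_seq.rep_eq minus_conv_seq.rep_eq)
  have "uniformly_Cauchy_on UNIV (\<lambda>n. apply_bcontfun (Rep_conv_seq (X n)))"
  proof (rule uniformly_Cauchy_onI)
    fix e :: real assume "0 < e"
    then obtain M where "\<And>m n. m \<ge> M \<Longrightarrow> n \<ge> M \<Longrightarrow> dist (X m) (X n) < e"
      using X by (meson metric_CauchyD)
    then show "\<exists>M. \<forall>x\<in>UNIV. \<forall>m\<ge>M. \<forall>n\<ge>M. dist (Rep_conv_seq (X m) x) (Rep_conv_seq (X n) x) < e"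
      by (metis d dist_fun_lt_imp_dist_val_lt)
  qed
  then obtain l where "uniform_limit UNIV (\<lambda>n. apply_bcontfun (Rep_conv_seq (X n))) l sequentially"
    using Cauchy_uniformly_convergent uniformly_convergent_on_def by blast
  then obtain f where f: "(\<lambda>n. Rep_conv_seq (X n)) \<longlonglongrightarrow> f"
    by (rule uniform_limit_bcontfunE) auto
  have u: "uniform_limit UNIV (\<lambda>n. apply_bcontfun (Rep_conv_seq (X n))) f sequentially"
    by (rule tendsto_bcontfun_uniform_limit[OF f])
  have "Cauchy (apply_bcontfun f)"
  proof (rule metric_CauchyI)
    fix e :: real assume e: "0 < e"
    then have "\<forall>\<^sub>F n in sequentially. \<forall>k. dist (Rep_conv_seq (X n) k) (f k) < e / 3"
      using uniform_limitD[OF u, of "e / 3"] by simp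
    then obtain n where n: "\<And>k. dist (Rep_conv_seq (X n) k) (f k) < e / 3"
      by (auto simp: eventually_sequentially)
    have "Cauchy (apply_bcontfun (Rep_conv_seq (X n)))"
      using Rep_conv_seq[of "X n"] by (simp add: convergent_Cauchy)
    then obtain M where M: "\<And>i j. i \<ge> M \<Longrightarrow> j \<ge> M \<Longrightarrow>
        dist (Rep_conv_seq (X n) i) (Rep_conv_seq (X n) j) < e / 3"
      using metric_CauchyD[of _ "e / 3"] e by (metis zero_less_divide_iff zero_less_numeral)
    have "dist (f i) (f j) < e" if "i \<ge> M" "j \<ge> M" for i j
      using n[of i] n[of j] M[OF that]
        dist_triangle[of "f i" "f j" "Rep_conv_seq (X n) i"]
        dist_triangle[of "Rep_conv_seq (X n) i" "f j" "Rep_conv_seq (X n) j"]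
      by (simp add: dist_commute)
    then show "\<exists>M. \<forall>m\<ge>M. \<forall>n\<ge>M. dist (f m) (f n) < e" by blast
  qed
  then have "f \<in> {f. convergent (apply_bcontfun f)}"
    by (simp add: Cauchy_convergent)
  then have "Rep_conv_seq (Abs_conv_seq f) = f" by (rule Abs_conv_seq_inverse)
  then have "X \<longlonglongrightarrow> Abs_conv_seq f"
    using f by (simp add: tendsto_dist_iff[of _ f] tendsto_dist_iff[of X] flip: d)
  then show "convergent X" by (rule convergentI)
qed

lemma conv_seq_ext:
  "(\<And>n. Rep_conv_seq x n = Rep_conv_seq y n) \<Longrightarrow> x = y"
  by (simp add: bcontfun_eqI Rep_conv_seq_inject[symmetric])

lemma conv_seq_of:
  fixes s :: "nat \<Rightarrow> 'k::{real_normed_field,banach}"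
  assumes "convergent s"
  shows "apply_bcontfun (Rep_conv_seq (Abs_conv_seq (Bcontfun s))) = s"
proof -
  have "s \<in> bcontfun"
    using convergent_imp_bounded assms by (auto simp: bcontfun_def convergent_def)
  then have "apply_bcontfun (Bcontfun s) = s" by (rule Bcontfun_inverse)
  then show ?thesis using assms by (simp add: Abs_conv_seq_inverse)
qed

lemma completion_exists:
  "\<exists>(smul :: 'k::{real_normed_field,banach} \<Rightarrow> 'k conv_seq \<Rightarrow> 'k conv_seq) \<iota>. is_completion smul \<iota>"
proof -
  define mk where "mk = (\<lambda>s :: nat \<Rightarrow> 'k. Abs_conv_seq (Bcontfun s))"
  have mk: "convergent s \<Longrightarrow> Rep_conv_seq (mk s) n = s n" for s n
    unfolding mk_def by (simp add: conv_seq_of)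
  have conv: "convergent (apply_bcontfun (Rep_conv_seq x))" for x :: "'k conv_seq"
    using Rep_conv_seq[of x] by simp
  define smul where "smul = (\<lambda>c x. mk (\<lambda>n. c * Rep_conv_seq x n))"
  have smul: "Rep_conv_seq (smul c x) n = c * Rep_conv_seq x n" for c x n
    unfolding smul_def by (rule mk) (intro convergent_mult convergent_const conv)
  define \<iota> where "\<iota> = (\<lambda>a :: nat \<Rightarrow>\<^sub>0 'k. mk (\<lambda>n. \<Sum>j\<le>n. Poly_Mapping.lookup a j))"
  have psum: "convergent (\<lambda>n. \<Sum>j\<le>n. Poly_Mapping.lookup a j)" for a :: "nat \<Rightarrow>\<^sub>0 'k"
  proof -
    have "summable (Poly_Mapping.lookup a)"
      by (rule summable_finite[of "Poly_Mapping.keys a"]) (auto simp: in_keys_iff)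
    then show ?thesis by (simp add: summable_iff_convergent')
  qed
  have \<iota>: "Rep_conv_seq (\<iota> a) n = (\<Sum>j\<le>n. Poly_Mapping.lookup a j)" for a n
    unfolding \<iota>_def by (rule mk[OF psum])
  have nrm: "norm x = (SUP n. norm (Rep_conv_seq x n))" for x :: "'k conv_seq"
  proof (rule antisym)
    have "bdd_above (range (\<lambda>n. norm (Rep_conv_seq x n)))"
      by (rule bdd_aboveI2[of _ _ "norm (Rep_conv_seq x)"]) (rule norm_bounded)
    then show "norm x \<le> (SUP n. norm (Rep_conv_seq x n))"
      unfolding norm_conv_seq.rep_eq by (intro norm_bound cSUP_upper) auto
    show "(SUP n. norm (Rep_conv_seq x n)) \<le> norm x"
      unfolding norm_conv_seq.rep_eq by (intro cSUP_least norm_bounded) auto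
  qed
  have vs: "vector_space smul"
    by unfold_locales
      (rule conv_seq_ext, simp add: smul plus_conv_seq.rep_eq algebra_simps)+
  have "norm (smul c x) = norm c * norm x" for c x
  proof (cases "c = 0")
    case True
    then have "smul c x = 0" by (intro conv_seq_ext) (simp add: smul zero_conv_seq.rep_eq)
    then show ?thesis using True by simp
  next
    case False
    have le: "norm (smul c x) \<le> norm c * norm x" for c x
      unfolding norm_conv_seq.rep_eq
      by (rule norm_bound) (simp add: smul norm_mult mult_left_mono norm_bounded)
    have "smul (inverse c) (smul c x) = x"
      using False by (intro conv_seq_ext) (simp add: smul)
    then have "norm x \<le> inverse (norm c) * norm (smul c x)"
      using le[of "inverse c" "smul c x"] by (simp add: norm_inverse)
    then have "norm c * norm x \<le> norm (smul c x)"
      using False by (simp add: field_simps)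
    then show ?thesis using le[of c x] by simp
  qed
  moreover have "smul (of_real r) x = r *\<^sub>R x" for r x
    by (intro conv_seq_ext) (simp add: smul scaleR_conv_seq.rep_eq scaleR_conv_of_real)
  ultimately have bo: "banach_over smul" using vs by (simp add: banach_over_def)
  have vsc: "vector_space (c00_scale :: 'k \<Rightarrow> _)"
    by unfold_locales
      (rule poly_mapping_eqI, simp add: lookup_c00_scale lookup_add algebra_simps)+
  have lin: "Vector_Spaces.linear c00_scale smul \<iota>"
  proof -
    have "\<iota> (a + b) = \<iota> a + \<iota> b" for a b
      by (intro conv_seq_ext) (simp add: \<iota> plus_conv_seq.rep_eq lookup_add sum.distrib)
    moreover have "\<iota> (c00_scale c a) = smul c (\<iota> a)" for c a
      by (intro conv_seq_ext) (simp add: \<iota> smul lookup_c00_scale sum_distrib_left)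
    ultimately show ?thesis
      by (simp add: Vector_Spaces.linear_iff vs vsc)
  qed
  have iso: "norm (\<iota> a) = c00_norm a" for a
    by (simp add: nrm \<iota> c00_norm_def)
  have "x \<in> closure (range \<iota>)" for x
  proof (rule closure_approachable[THEN iffD2], intro allI impI)
    fix e :: real assume e: "0 < e"
    define s where "s = apply_bcontfun (Rep_conv_seq x)"
    have "Cauchy s" using conv[of x] by (simp add: s_def convergent_Cauchy)
    then obtain M where M: "\<And>n. n \<ge> M \<Longrightarrow> dist (s M) (s n) < e / 2"
      using metric_CauchyD[of s "e / 2"] e by (metis half_gt_zero order_refl)
    define h where "h = (\<lambda>j. if j = 0 then s 0 else if j \<le> M then s j - s (j - 1) else 0)"
    have "finite {j. h j \<noteq> 0}"
      by (rule finite_subset[of _ "{..M}"]) (auto simp: h_def split: if_splits)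
    then have lk: "Poly_Mapping.lookup (Abs_poly_mapping h) = h" by simp
    have ps: "(\<Sum>j\<le>n. h j) = s (min n M)" for n
    proof (induction n)
      case 0
      then show ?case by (simp add: h_def)
    next
      case (Suc n)
      then show ?case by (cases "Suc n \<le> M") (auto simp: h_def min_def le_Suc_eq not_less_eq_eq dest: le_antisym)
    qed
    have "dist (s (min n M)) (s n) \<le> e / 2" for n
      using M[of n] e by (cases "n \<le> M") (auto simp: min_def)
    then have "dist (Rep_conv_seq (\<iota> (Abs_poly_mapping h))) (Rep_conv_seq x) \<le> e / 2"
      by (intro dist_bound) (simp add: \<iota> lk ps flip: s_def)
    then have "dist (\<iota> (Abs_poly_mapping h)) x < e"
      using e by (simp add: dist_norm norm_conv_seq.rep_eq minus_conv_seq.rep_eq)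
    then show "\<exists>y\<in>range \<iota>. dist y x < e" by blast
  qed
  then have "closure (range \<iota>) = UNIV" by blast
  then have "is_completion smul \<iota>"
    using bo lin iso by (simp add: is_completion_def)
  then show ?thesis by blast
qed

end

theory Submission
  imports Defs "HOL-Library.Discrete_Functions" "HOL-Real_Asymp.Real_Asymp"
begin

text \<open>
  Take \<open>y\<close> with entries built from blocks: block \<open>k\<close> is \<open>1/k\<close> followed by \<open>2k\<close> entries
  \<open>-1/(2k\<^sup>2)\<close> that cancel it, so the partial sums tend to 0. Let \<open>A\<close> be a \<open>t\<close>-greedy set and
  \<open>1/k\<close> the first positive entry missing from it. Then \<open>A\<close> contains positive entries of total
  at least \<open>1 + \<dots> + 1/(k-1) \<ge> ln k\<close>, while every entry in \<open>A\<close> has modulus at least \<open>t/k\<close>. Hence its negative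
  entries lie in blocks up to \<open>(k/t)\<^sup>1\<^sup>/\<^sup>2\<close>, which costs at most \<open>ln (k/t) / 2 + 1\<close>, and
  \<open>|A| \<le> (k/t + 1)\<^sup>2\<close>, which makes \<open>k\<close> large when \<open>|A|\<close> is. The norm of a greedy sum is at least
  the modulus of the sum of all its entries.
\<close>

section \<open>Coordinates and norms in a completion of c00\<close>

lemma coord_dual:
  assumes "is_completion smul \<iota>"
  shows "coord smul \<iota> i \<in> dual_space smul"
    and "coord smul \<iota> i (basis_vec \<iota> j) = (if i = j then 1 else 0)"
  using theI'[OF coord_ex1[OF assms, of i]] by (auto simp: coord_def)

lemma sum_smul_basis_vec:
  assumes "is_completion smul \<iota>"
  shows "(\<Sum>i\<in>A. smul (c i) (basis_vec \<iota> i)) = \<iota> (\<Sum>i\<in>A. Poly_Mapping.single i (c i))"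
proof -
  interpret L: Vector_Spaces.linear c00_scale smul \<iota>
    using assms by (simp add: is_completion_def)
  have "c00_scale (c i) (Poly_Mapping.single i 1) = Poly_Mapping.single i (c i)" for i
    by (rule poly_mapping_eqI) (simp add: lookup_c00_scale lookup_single when_def)
  then show ?thesis
    by (simp add: L.sum basis_vec_def flip: L.scale)
qed

lemma lookup_sum_single:
  assumes "finite A"
  shows "Poly_Mapping.lookup (\<Sum>i\<in>A. Poly_Mapping.single i (c i)) j = (if j \<in> A then c j else 0)"
  using assms by (simp add: lookup_sum lookup_single when_def)

text \<open>The norm dominates every partial sum, and a partial sum reaching past \<open>A\<close>
  is the whole sum over \<open>A\<close>.\<close>

lemma norm_sum_le_norm_sum_smul:
  assumes "is_completion smul \<iota>" and "finite A"
  shows "norm (\<Sum>i\<in>A. c i) \<le> norm (\<Sum>i\<in>A. smul (c i) (basis_vec \<iota> i))"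
proof -
  obtain n where n: "A \<subseteq> {..n}"
    using assms(2) by (meson finite_nat_iff_bounded_le)
  define x where "x = (\<Sum>i\<in>A. Poly_Mapping.single i (c i))"
  have "(\<Sum>j\<le>n. Poly_Mapping.lookup x j) = (\<Sum>i\<in>A. c i)"
    using n by (simp add: x_def lookup_sum_single[OF assms(2)] sum.If_cases Int_absorb1)
  then show ?thesis
    using norm_partial_sum_le[of x n] assms(1)
    by (simp add: sum_smul_basis_vec[OF assms(1)] x_def is_completion_def)
qed

text \<open>The truncations of \<open>c\<close> are Cauchy because the norm of c00 only sees partial
  sums; the coordinates of their limit follow by continuity.\<close>

lemma ex_coord_eq_summable:
  fixes smul :: "'k::{real_normed_field,banach} \<Rightarrow> 'x::banach \<Rightarrow> 'x"
  assumes compl: "is_completion smul \<iota>" and "summable c"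
  obtains y where "\<And>i. coord smul \<iota> i y = c i"
proof -
  interpret L: Vector_Spaces.linear c00_scale smul \<iota>
    using compl by (simp add: is_completion_def)
  define x where "x n = (\<Sum>i<n. Poly_Mapping.single i (c i))" for n
  have lookup_x: "Poly_Mapping.lookup (x n) j = (if j < n then c j else 0)" for n j
    by (simp add: x_def lookup_sum_single)
  have sum_x: "(\<Sum>j\<le>p. Poly_Mapping.lookup (x n) j) = sum c {..<min (Suc p) n}" for p n
    by (simp add: lookup_x sum.If_cases) (intro sum.cong; auto)
  have "Cauchy (\<lambda>n. \<iota> (x n))"
  proof (rule metric_CauchyI)
    fix e :: real assume e: "0 < e"
    have "Cauchy (\<lambda>n. sum c {..<n})"
      using \<open>summable c\<close> by (simp add: summable_iff_convergent convergent_Cauchy)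
    then obtain M where M: "\<And>m n. m \<ge> M \<Longrightarrow> n \<ge> M \<Longrightarrow> dist (sum c {..<m}) (sum c {..<n}) < e / 2"
      using metric_CauchyD[of _ "e / 2"] e by (metis half_gt_zero)
    have "dist (\<iota> (x m)) (\<iota> (x n)) < e" if mn: "m \<ge> M" "n \<ge> M" for m n
    proof -
      have "norm (\<Sum>j\<le>p. Poly_Mapping.lookup (x m - x n) j) \<le> e / 2" for p
      proof -
        have "(\<Sum>j\<le>p. Poly_Mapping.lookup (x m - x n) j)
            = sum c {..<min (Suc p) m} - sum c {..<min (Suc p) n}"
          by (simp add: lookup_minus sum_subtractf sum_x)
        \<comment> \<open>For \<open>Suc p < M\<close> both minima equal \<open>Suc p\<close> and
          the difference is 0; otherwise both are at least \<open>M\<close>.\<close>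
        moreover have "norm (sum c {..<min (Suc p) m} - sum c {..<min (Suc p) n}) \<le> e / 2"
        proof (cases "Suc p < M")
          case True
          then show ?thesis using mn e by (simp add: min_def)
        next
          case False
          then show ?thesis
            using M[of "min (Suc p) m" "min (Suc p) n"] mn by (simp add: dist_norm)
        qed
        ultimately show ?thesis by simp
      qed
      then have "c00_norm (x m - x n) \<le> e / 2"
        unfolding c00_norm_def by (intro cSUP_least) auto
      then show ?thesis
        using e compl by (simp add: dist_norm is_completion_def flip: L.diff)
    qed
    then show "\<exists>M. \<forall>m\<ge>M. \<forall>n\<ge>M. dist (\<iota> (x m)) (\<iota> (x n)) < e" by blast
  qed
  then obtain y where y: "(\<lambda>n. \<iota> (x n)) \<longlonglongrightarrow> y"
    by (meson Cauchy_convergent convergent_def)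
  have "coord smul \<iota> i y = c i" for i
  proof -
    have bl: "bounded_linear (coord smul \<iota> i)"
      and lin: "Vector_Spaces.linear smul (*) (coord smul \<iota> i)"
      using coord_dual(1)[OF compl, of i] by (auto simp: dual_space_def)
    interpret F: Vector_Spaces.linear smul "(*)" "coord smul \<iota> i" by (rule lin)
    have "coord smul \<iota> i (\<iota> (x n)) = (if i < n then c i else 0)" for n
      unfolding x_def sum_smul_basis_vec[OF compl, symmetric]
      by (simp add: F.sum F.scale coord_dual(2)[OF compl] if_distrib cong: if_cong)
    then have "\<forall>\<^sub>F n in sequentially. coord smul \<iota> i (\<iota> (x n)) = c i"
      by (intro eventually_mono[OF eventually_gt_at_top[of i]]) simp
    then have "(\<lambda>n. coord smul \<iota> i (\<iota> (x n))) \<longlonglongrightarrow> c i"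
      by (rule tendsto_eventually)
    then show ?thesis
      using bounded_linear.tendsto[OF bl y] LIMSEQ_unique by blast
  qed
  then show thesis by (rule that)
qed

section \<open>Existence of greedy sets\<close>

text \<open>Add an index of largest remaining value, one at a time. This keeps the infimum over
  greedy sums from ranging over the empty set.\<close>

lemma ex_top_set:
  fixes f :: "nat \<Rightarrow> real"
  assumes lim: "f \<longlonglongrightarrow> 0" and nonneg: "\<And>i. 0 \<le> f i"
  shows "\<exists>A. finite A \<and> card A = m \<and> (\<forall>i\<in>A. \<forall>j. j \<notin> A \<longrightarrow> f j \<le> f i)"
proof (induction m)
  case 0
  then show ?case by (intro exI[of _ "{}"]) simp
next
  case (Suc m)
  then obtain A where A: "finite A" "card A = m" "\<And>i j. i \<in> A \<Longrightarrow> j \<notin> A \<Longrightarrow> f j \<le> f i"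
    by blast
  obtain k where k: "k \<notin> A" "\<And>j. j \<notin> A \<Longrightarrow> f j \<le> f k"
  proof (cases "\<exists>j. j \<notin> A \<and> f j > 0")
    case True
    then obtain l where l: "l \<notin> A" "f l > 0" by blast
    \<comment> \<open>Since \<open>f\<close> tends to 0, only finitely many values reach
      \<open>f l > 0\<close>, so a maximum outside \<open>A\<close> is attained.\<close>
    define B where "B = {j. j \<notin> A \<and> f l \<le> f j}"
    have "\<forall>\<^sub>F j in sequentially. f j < f l" using lim l(2) by (rule order_tendstoD)
    then obtain N where "\<And>j. j \<ge> N \<Longrightarrow> f j < f l" by (auto simp: eventually_sequentially)
    then have "B \<subseteq> {..<N}" unfolding B_def by (auto simp: not_le[symmetric])
    then have B: "finite B" by (rule finite_subset) simp
    have "l \<in> B" using l by (simp add: B_def)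
    then have "Max (f ` B) \<in> f ` B" using B by (intro Max_in) auto
    then obtain k where "k \<in> B" "f k = Max (f ` B)" by auto
    moreover from this(2) have "f j \<le> f k" if "j \<in> B" for j
      using B that by simp
    ultimately have "k \<notin> A" "\<And>j. j \<notin> A \<Longrightarrow> f j \<le> f k"
      by (auto simp: B_def) (meson nle_le order_trans)
    then show thesis by (rule that)
  next
    case False
    \<comment> \<open>All values outside \<open>A\<close> are 0, so any index there will do.\<close>
    obtain k where "k \<notin> A" using A(1) ex_new_if_finite infinite_UNIV_nat by blast
    then show thesis using that[of k] False nonneg by (meson not_le order_trans)
  qed
  have "\<forall>i\<in>insert k A. \<forall>j. j \<notin> insert k A \<longrightarrow> f j \<le> f i" using A(3) k by auto
  then show ?case using A(1,2) k(1) by (intro exI[of _ "insert k A"]) auto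
qed

section \<open>The sawtooth series and its convergence\<close>

text \<open>
  Block \<open>k \<ge> 1\<close> occupies \<open>{k\<^sup>2..<(k+1)\<^sup>2}\<close>. The entry at 0 is \<open>1/0 = 0\<close>.
\<close>

definition spike :: "nat \<Rightarrow> real" where
  "spike j = (if j = (floor_sqrt j)\<^sup>2 then 1 / real (floor_sqrt j) else 0)"

definition drift :: "nat \<Rightarrow> real" where
  "drift j = (if j = (floor_sqrt j)\<^sup>2 then 0 else 1 / (2 * (real (floor_sqrt j))\<^sup>2))"

text \<open>Kept as a difference of nonnegative sequences: over a greedy set, \<open>spike\<close>
  is bounded below on a subset and \<open>drift\<close> above on a superset.\<close>

definition sawtooth :: "nat \<Rightarrow> real" where
  "sawtooth j = spike j - drift j"

lemma spike_nonneg: "0 \<le> spike j" and drift_nonneg: "0 \<le> drift j"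
  by (simp_all add: spike_def drift_def)

lemma sum_spike: "(\<Sum>j\<in>power2 ` {1..n}. spike j) = harm n"
proof -
  have "inj_on power2 {1..n}" by (auto simp: inj_on_def)
  then show ?thesis by (simp add: sum.reindex harm_def spike_def inverse_eq_divide)
qed

text \<open>Within block \<open>k\<close> the partial sums start at \<open>1/k\<close> and fall
  linearly to 0. At \<open>n = 0\<close> both sides are 0 by division by zero.\<close>

lemma sum_sawtooth:
  "(\<Sum>j\<le>n. sawtooth j)
    = 1 / real (floor_sqrt n) - (real n - (real (floor_sqrt n))\<^sup>2) / (2 * (real (floor_sqrt n))\<^sup>2)"
proof (induction n)
  case 0
  show ?case by (simp add: sawtooth_def spike_def drift_def)
next
  case (Suc n)
  define k where "k = floor_sqrt n"
  show ?case
  proof (cases "\<exists>m. Suc n = m\<^sup>2")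
    case True
    then have fs: "floor_sqrt (Suc n) = Suc k"
      by (auto simp: floor_sqrt_Suc k_def)
    have sq: "Suc n = (Suc k)\<^sup>2" using True fs by auto
    \<comment> \<open>\<open>n\<close> ends block \<open>k\<close>, where the spike has just been
      cancelled.\<close>
    then have n: "real n = (real k)\<^sup>2 + 2 * real k"
      by (simp add: power2_eq_square flip: of_nat_mult of_nat_add)
    have "(\<Sum>j\<le>n. sawtooth j) = 0"
      unfolding Suc.IH k_def[symmetric] n by (simp add: power2_eq_square)
    moreover have "sawtooth (Suc n) = 1 / real (Suc k)"
      by (simp add: sawtooth_def spike_def drift_def fs flip: sq)
    moreover have "real (Suc n) = (real (Suc k))\<^sup>2" by (simp only: sq of_nat_power)
    ultimately show ?thesis unfolding sum.atMost_Suc fs by (simp del: of_nat_Suc)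
  next
    case False
    then have fs: "floor_sqrt (Suc n) = k"
      by (auto simp: floor_sqrt_Suc k_def)
    have "Suc n \<noteq> k\<^sup>2" using False by auto
    then have "sawtooth (Suc n) = - (1 / (2 * (real k)\<^sup>2))"
      by (simp add: sawtooth_def spike_def drift_def fs)
    then show ?thesis
      unfolding sum.atMost_Suc Suc.IH fs k_def[symmetric] by (simp add: add_divide_distrib diff_divide_distrib)
  qed
qed

lemma summable_sawtooth: "summable sawtooth"
proof -
  have "filterlim floor_sqrt at_top sequentially"
    unfolding filterlim_at_top
  proof
    fix K
    show "\<forall>\<^sub>F n in sequentially. K \<le> floor_sqrt n"
      using eventually_ge_at_top[of "K\<^sup>2"] by eventually_elim (rule le_floor_sqrtI)
  qed
  then have lim: "(\<lambda>n. 1 / real (floor_sqrt n)) \<longlonglongrightarrow> 0"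
    by (rule filterlim_compose[OF lim_1_over_n])
  have "(\<lambda>n. \<Sum>j\<le>n. sawtooth j) \<longlonglongrightarrow> 0"
  proof (rule real_tendsto_sandwich[OF _ _ tendsto_const lim])
    have "0 \<le> (\<Sum>j\<le>n. sawtooth j) \<and> (\<Sum>j\<le>n. sawtooth j) \<le> 1 / real (floor_sqrt n)" for n
    proof (cases "n = 0")
      case True
      then show ?thesis by (simp add: sawtooth_def spike_def drift_def)
    next
      case False
      define k where "k = floor_sqrt n"
      have k: "0 < k" using False by (simp add: k_def)
      have "k\<^sup>2 \<le> n" unfolding k_def by (rule floor_sqrt_power2_le)
      then have lower: "(real k)\<^sup>2 \<le> real n" by (metis of_nat_le_iff of_nat_power)
      \<comment> \<open>An index of block \<open>k\<close> is at most \<open>2 * k\<close> past its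
        start, so the drift so far does not exceed the spike.\<close>
      have "n \<le> k\<^sup>2 + 2 * k"
        using Suc_floor_sqrt_power2_gt[of n] by (simp add: k_def power2_eq_square)
      then have "real n \<le> real (k\<^sup>2 + 2 * k)" by (rule of_nat_mono)
      then have "real n - (real k)\<^sup>2 \<le> 2 * real k" by simp
      then have "(real n - (real k)\<^sup>2) / (2 * (real k)\<^sup>2) \<le> (2 * real k) / (2 * (real k)\<^sup>2)"
        by (rule divide_right_mono) simp
      also have "\<dots> = 1 / real k" using k by (simp add: power2_eq_square)
      finally show ?thesis using lower by (simp add: sum_sawtooth flip: k_def)
    qed
    then show "\<forall>\<^sub>F n in sequentially. 0 \<le> (\<Sum>j\<le>n. sawtooth j)"
      and "\<forall>\<^sub>F n in sequentially. (\<Sum>j\<le>n. sawtooth j) \<le> 1 / real (floor_sqrt n)"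
      by auto
  qed
  then show ?thesis by (auto simp: summable_iff_convergent' convergent_def)
qed

text \<open>The range is exactly the blocks up to \<open>n\<close>; block \<open>k\<close>
  contributes \<open>2 * k\<close> terms of total \<open>1/k\<close>, and index 0 contributes
  0.\<close>

lemma sum_drift: "(\<Sum>j<(Suc n)\<^sup>2. drift j) = harm n"
proof (induction n)
  case 0
  show ?case by (simp add: drift_def harm_def)
next
  case (Suc n)
  define k where "k = Suc n"
  have "0 < k" by (simp add: k_def)
  have fs: "floor_sqrt j = k" if "j \<in> {k\<^sup>2..<(Suc k)\<^sup>2}" for j
    using that by (intro floor_sqrt_unique) auto
  have "{..<(Suc k)\<^sup>2} = {..<k\<^sup>2} \<union> {k\<^sup>2..<(Suc k)\<^sup>2}"
    by (auto simp: power2_eq_square)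
  then have "(\<Sum>j<(Suc k)\<^sup>2. drift j) = (\<Sum>j<k\<^sup>2. drift j) + (\<Sum>j=k\<^sup>2..<(Suc k)\<^sup>2. drift j)"
    by (simp add: sum.union_disjoint ivl_disj_int)
  also have "(\<Sum>j=k\<^sup>2..<(Suc k)\<^sup>2. drift j) = (\<Sum>j\<in>{k\<^sup>2<..<(Suc k)\<^sup>2}. 1 / (2 * (real k)\<^sup>2))"
    by (rule sum.mono_neutral_cong_right) (auto simp: drift_def fs)
  also have "\<dots> = (2 * real k) / (2 * (real k)\<^sup>2)"
    by (simp add: power2_eq_square)
  also have "\<dots> = inverse (real k)" using \<open>0 < k\<close> by (simp add: power2_eq_square inverse_eq_divide)
  finally show ?case using Suc.IH by (simp add: k_def harm_Suc)
qed

section \<open>Sums of the sawtooth over greedy sets\<close>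

text \<open>In block \<open>n\<close> spikes have size \<open>1/n\<close> but drift entries have
  order \<open>1/n^2\<close>, so a threshold on the modulus confines the drift to far fewer
  blocks.\<close>

lemma real_floor_sqrt_le_divide:
  assumes "0 < t" and "t \<le> 1" and "0 < k" and "t / real k \<le> \<bar>sawtooth i\<bar>"
  shows "real (floor_sqrt i) \<le> real k / t"
    and "i \<noteq> (floor_sqrt i)\<^sup>2 \<Longrightarrow> (real (floor_sqrt i))\<^sup>2 \<le> real k / t"
proof -
  define n where "n = floor_sqrt i"
  have pos: "0 < t / real k" using assms(1,3) by simp
  \<comment> \<open>A nonzero entry excludes index 0, the only one with block number 0.\<close>
  then have "\<bar>sawtooth i\<bar> \<noteq> 0" using assms(4) by linarith
  then have n: "0 < n"
    by (auto simp: n_def sawtooth_def spike_def drift_def intro!: gr0I)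
  have *: "x \<le> real k / t" if "0 < x" "t / real k \<le> 1 / x" for x :: real
    using that assms(1,3) by (simp add: field_simps)
  have nonsq: "(real n)\<^sup>2 \<le> real k / t" if "i \<noteq> n\<^sup>2"
  proof -
    have "\<bar>sawtooth i\<bar> \<le> 1 / (real n)\<^sup>2"
      using that n by (simp add: sawtooth_def spike_def drift_def n_def[symmetric] field_simps)
    then show ?thesis using assms(4) n by (intro *) auto
  qed
  then show "i \<noteq> (floor_sqrt i)\<^sup>2 \<Longrightarrow> (real (floor_sqrt i))\<^sup>2 \<le> real k / t"
    by (simp add: n_def)
  show "real (floor_sqrt i) \<le> real k / t"
  proof (cases "i = n\<^sup>2")
    case True
    then have "\<bar>sawtooth i\<bar> = 1 / real n"
      by (simp add: sawtooth_def spike_def drift_def)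
    then show ?thesis using * n assms(4) by (simp add: n_def)
  next
    case False
    have "real n \<le> (real n)\<^sup>2" using n by (simp add: power2_eq_square)
    also have "\<dots> \<le> real k / t" using False by (rule nonsq)
    finally show ?thesis by (simp add: n_def)
  qed
qed

text \<open>Half of \<open>ln k\<close> survives: the sum is at least
  \<open>ln k - ((ln k - ln t) / 2 + 1)\<close>, and \<open>k\<close> is replaced by its lower bound
  \<open>t * (sqrt (card A) - 1)\<close>.\<close>

lemma sum_sawtooth_greedy_ge:
  assumes t: "0 < t" "t \<le> 1" and fin: "finite A" and card: "1 < card A"
    and greedy: "\<And>i j. i \<in> A \<Longrightarrow> j \<notin> A \<Longrightarrow> t * \<bar>sawtooth j\<bar> \<le> \<bar>sawtooth i\<bar>"
  shows "(\<Sum>i\<in>A. sawtooth i) \<ge> (ln (t * (sqrt (card A) - 1)) + ln t) / 2 - 1"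
proof -
  define k where "k = (LEAST k. 0 < k \<and> k\<^sup>2 \<notin> A)"
  have "infinite (power2 ` {1::nat..})"
    by (subst finite_image_iff) (auto simp: inj_on_def infinite_Ici)
  then have "\<not> power2 ` {1..} \<subseteq> A"
    using fin finite_subset by blast
  then have "\<exists>k. 0 < k \<and> k\<^sup>2 \<notin> A"
    by (auto simp: Suc_le_eq)
  then have k: "0 < k" "k\<^sup>2 \<notin> A"
    unfolding k_def by (metis (mono_tags, lifting) LeastI)+
  have least: "l\<^sup>2 \<in> A" if "0 < l" "l < k" for l
    using not_less_Least[of l] that unfolding k_def by blast
  \<comment> \<open>Greediness against the missing index \<open>k^2\<close>, whose entry is
    \<open>1/k\<close>.\<close>
  have "t / real k \<le> \<bar>sawtooth i\<bar>" if "i \<in> A" for i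
    using greedy[OF that k(2)] by (simp add: sawtooth_def spike_def drift_def)
  note root = real_floor_sqrt_le_divide[OF t k(1) this]

  have card_le: "sqrt (card A) - 1 \<le> real k / t"
  proof -
    \<comment> \<open>\<open>A\<close> meets no block beyond \<open>N\<close>, so it lies below the
      start of block \<open>N + 1\<close>.\<close>
    define N where "N = nat \<lfloor>real k / t\<rfloor>"
    have "i < (Suc N)\<^sup>2" if "i \<in> A" for i
    proof -
      have "floor_sqrt i \<le> N" using root(1)[OF that] by (simp add: N_def le_nat_floor)
      then show ?thesis by (metis le_floor_sqrt_iff not_less not_less_eq_eq)
    qed
    then have "A \<subseteq> {..<(Suc N)\<^sup>2}" by auto
    then have "card A \<le> (Suc N)\<^sup>2" by (metis card_lessThan card_mono finite_lessThan)
    then have "real (card A) \<le> (real (Suc N))\<^sup>2" by (metis of_nat_mono of_nat_power)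
    then have "sqrt (card A) \<le> real (Suc N)" by (rule real_le_lsqrt[rotated]) simp
    moreover have "real N \<le> real k / t" using t by (simp add: N_def)
    ultimately show ?thesis by simp
  qed

  \<comment> \<open>The last block in which \<open>A\<close> can contain drift entries; it is
    positive, so \<open>ln L\<close> is meaningful.\<close>
  define L where "L = nat \<lfloor>sqrt (real k / t)\<rfloor>"
  have "1 \<le> real k / t" using t k(1) by (simp add: field_simps)
  then have L: "0 < L" "real L \<le> sqrt (real k / t)"
    by (auto simp: L_def)
  have "ln (real k) \<le> harm (k - 1)"
    using ln_le_harm[of "k - 1"] k(1) by (simp add: of_nat_diff)
  also have "\<dots> = (\<Sum>j\<in>power2 ` {1..k - 1}. spike j)" by (rule sum_spike[symmetric])
  \<comment> \<open>By minimality of \<open>k\<close>, \<open>A\<close> contains the squares of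
    \<open>1\<close> to \<open>k - 1\<close>.\<close>
  also have "\<dots> \<le> (\<Sum>j\<in>A. spike j)"
    using least k(1) by (intro sum_mono2 fin spike_nonneg) auto
  finally have spikes: "ln (real k) \<le> (\<Sum>j\<in>A. spike j)" .

  have "(\<Sum>j\<in>A. drift j) = (\<Sum>j\<in>A - range power2. drift j)"
    by (rule sum.mono_neutral_right[OF fin]) (auto simp: drift_def)
  also have "\<dots> \<le> (\<Sum>j<(Suc L)\<^sup>2. drift j)"
  proof (intro sum_mono2 subsetI)
    fix i assume i: "i \<in> A - range power2"
    then have "(real (floor_sqrt i))\<^sup>2 \<le> real k / t" by (intro root(2)) auto
    then have "real (floor_sqrt i) \<le> sqrt (real k / t)" by (rule real_le_rsqrt)
    then have "floor_sqrt i \<le> L" by (simp add: L_def le_nat_floor)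
    then show "i \<in> {..<(Suc L)\<^sup>2}" by (metis le_floor_sqrt_iff lessThan_iff not_less not_less_eq_eq)
  qed (auto simp: drift_nonneg)
  also have "\<dots> = harm L" by (rule sum_drift)
  \<comment> \<open>\<open>harm n - ln n\<close> is decreasing and equals 1 at
    \<open>n = 1\<close>.\<close>
  also have "\<dots> \<le> ln (real L) + 1"
    using euler_mascheroni_sequence_decreasing[of 1 L] L(1) by (simp add: harm_def)
  finally have "(\<Sum>j\<in>A. drift j) \<le> ln (real L) + 1" .
  moreover have "ln (real L) \<le> ln (sqrt (real k / t))" using L by (intro ln_mono) auto
  moreover have "ln (sqrt (real k / t)) = (ln (real k) - ln t) / 2"
    using k(1) t by (simp add: ln_sqrt ln_div)
  ultimately have drifts: "(\<Sum>j\<in>A. drift j) \<le> (ln (real k) - ln t) / 2 + 1" by linarith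

  have "1 < sqrt (card A)" using card by simp
  then have "ln (t * (sqrt (card A) - 1)) \<le> ln (real k)"
    using card_le t by (intro ln_mono) (auto simp: field_simps)
  moreover have "(\<Sum>i\<in>A. sawtooth i) = (\<Sum>j\<in>A. spike j) - (\<Sum>j\<in>A. drift j)"
    by (simp add: sawtooth_def sum_subtractf)
  ultimately show ?thesis using spikes drifts by (simp add: field_simps)
qed

section \<open>Divergence of the norms of greedy sums\<close>

theorem mainTheorem3:
  fixes smul :: "'k::{real_normed_field,banach} \<Rightarrow> 'x::banach \<Rightarrow> 'x"
    and \<iota> :: "(nat \<Rightarrow>\<^sub>0 'k) \<Rightarrow> 'x"
  assumes "is_completion smul \<iota>"
  shows "\<exists>y.
    (\<forall>t. 0 < t \<and> t \<le> 1 \<longrightarrow>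
       filterlim (\<lambda>m. INF g\<in>greedy_sums smul \<iota> t m y. norm g) at_top sequentially) \<and>
    (\<forall>(m :: nat \<Rightarrow> nat) (G :: nat \<Rightarrow> 'x).
       strict_mono m \<and> (\<forall>j. 0 < m j) \<and> (\<forall>j. G j \<in> greedy_sums smul \<iota> 1 (m j) y) \<longrightarrow>
       filterlim (\<lambda>j. norm (G j - y)) at_top sequentially)"
proof -
  have "summable (\<lambda>i. of_real (sawtooth i) :: 'k)"
    using summable_sawtooth by (rule summable_of_real)
  then obtain y where coord_y: "\<And>i. coord smul \<iota> i y = of_real (sawtooth i)"
    using ex_coord_eq_summable[OF assms] by blast
  define \<phi> where "\<phi> t m = (ln (t * (sqrt (real m) - 1)) + ln t) / 2 - 1" for t :: real and m :: nat
  have \<phi>_lim: "filterlim (\<phi> t) at_top sequentially" if "0 < t" for t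
    unfolding \<phi>_def using that by real_asymp
  have \<phi>_le: "\<phi> t m \<le> norm g"
    if t: "0 < t" "t \<le> 1" and m: "1 < m" and g: "g \<in> greedy_sums smul \<iota> t m y" for t m g
  proof -
    obtain A where A: "greedy_set smul \<iota> t y A" "card A = m"
      and g_eq: "g = (\<Sum>i\<in>A. smul (of_real (sawtooth i)) (basis_vec \<iota> i))"
      using g by (auto simp: greedy_sums_def coord_y)
    have fin: "finite A" using A(1) by (simp add: greedy_set_def)
    have "\<phi> t m \<le> (\<Sum>i\<in>A. sawtooth i)"
      unfolding \<phi>_def A(2)[symmetric]
      by (rule sum_sawtooth_greedy_ge) (use t m A in \<open>auto simp: greedy_set_def coord_y\<close>)
    also have "\<dots> \<le> norm (\<Sum>i\<in>A. of_real (sawtooth i) :: 'k)"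
      by (simp flip: of_real_sum)
    also have "\<dots> \<le> norm g"
      unfolding g_eq by (rule norm_sum_le_norm_sum_smul[OF assms fin])
    finally show ?thesis .
  qed
  have nonempty: "greedy_sums smul \<iota> t m y \<noteq> {}" if t: "0 < t" "t \<le> 1" for t m
  proof -
    have "(\<lambda>i. \<bar>sawtooth i\<bar>) \<longlonglongrightarrow> 0"
      using summable_LIMSEQ_zero[OF summable_sawtooth] by (rule tendsto_rabs_zero)
    then obtain A where A: "finite A" "card A = m"
      "\<And>i j. i \<in> A \<Longrightarrow> j \<notin> A \<Longrightarrow> \<bar>sawtooth j\<bar> \<le> \<bar>sawtooth i\<bar>"
      using ex_top_set[of "\<lambda>i. \<bar>sawtooth i\<bar>" m] by auto
    \<comment> \<open>A 1-greedy set is \<open>t\<close>-greedy because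
      \<open>t \<le> 1\<close>.\<close>
    have "t * \<bar>sawtooth j\<bar> \<le> \<bar>sawtooth i\<bar>" if "i \<in> A" "j \<notin> A" for i j
      using A(3)[OF that] mult_right_mono[OF t(2), of "\<bar>sawtooth j\<bar>"] by simp
    then show ?thesis using A(1,2) by (auto simp: greedy_sums_def greedy_set_def coord_y)
  qed
  have "filterlim (\<lambda>m. INF g\<in>greedy_sums smul \<iota> t m y. norm g) at_top sequentially"
    if t: "0 < t" "t \<le> 1" for t
  proof (rule filterlim_at_top_mono[OF \<phi>_lim[OF t(1)]])
    show "\<forall>\<^sub>F m in sequentially. \<phi> t m \<le> (INF g\<in>greedy_sums smul \<iota> t m y. norm g)"
      using eventually_gt_at_top[of 1]
      by eventually_elim (intro cINF_greatest nonempty \<phi>_le t)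
  qed
  moreover have "filterlim (\<lambda>j. norm (G j - y)) at_top sequentially"
    if m: "strict_mono m" and G: "\<And>j. G j \<in> greedy_sums smul \<iota> 1 (m j) y" for m G
  proof -
    have "filterlim (\<lambda>j. \<phi> 1 (m j)) at_top sequentially"
      using \<phi>_lim[of 1] filterlim_subseq[OF m] by (auto intro: filterlim_compose)
    \<comment> \<open>By the reverse triangle inequality, subtracting the fixed \<open>y\<close>
      costs at most \<open>norm y\<close>.\<close>
    then have "filterlim (\<lambda>j. - norm y + \<phi> 1 (m j)) at_top sequentially"
      by (intro filterlim_tendsto_add_at_top[OF tendsto_const])
    moreover have "\<forall>\<^sub>F j in sequentially. - norm y + \<phi> 1 (m j) \<le> norm (G j - y)"
      using eventually_gt_at_top[of 1]
    proof eventually_elim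
      case (elim j)
      \<comment> \<open>Strict monotonicity gives \<open>j \<le> m j\<close>.\<close>
      then have "1 < m j" using seq_suble[OF m, of j] by simp
      then have "\<phi> 1 (m j) \<le> norm (G j)" using G by (intro \<phi>_le) auto
      then show ?case using norm_triangle_ineq2[of "G j" y] by simp
    qed
    ultimately show ?thesis by (rule filterlim_at_top_mono)
  qed
  ultimately show ?thesis by blast
qed

end
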